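(* Let $m\ge 2$ be an integer, let $f_{m,n}(z)=\sum_{j=0}^{n}\binom{n}{j}z^{\binom{j}{m}}$ for $n\ge 0$, and for $n\ge 1$ let $F_{m,n}(z)$ be the polynomial $$F_{m,n}(z):=\frac{f_{m,n}(z)^2-f_{m,n-1}(z)f_{m,n+1}(z)}{1-z}.$$ Then for every integer $n\ge m-1$ we have $F_{m,n}(z)>0$ for all real $z\ge 0$. In particular, for every real $z$ with $0\le z\le 1$ the sequence $(f_{m,n}(z))_{n\ge m-1}$ is log-concave.
   Context: Conventions: $\binom{j}{m}=0$ for $0\le j<m$, and $z^0=1$ (also at $z=0$). The numerator in the definition of $F_{m,n}$ vanishes at $z=1$ (since $f_{m,n}(1)=2^n$), so $F_{m,n}$ is a polynomial; its value at $z=1$ is the value of that polynomial. A sequence $(a_n)$ of real numbers is log-concave if $a_n^2\ge a_{n-1}a_{n+1}$ for all $n$ (for which the terms are in the sequence). *)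

theory Defs
  imports Complex_Main "HOL-Computational_Algebra.Polynomial"
begin

definition fpoly :: "nat \<Rightarrow> nat \<Rightarrow> real poly" where
  "fpoly m n = (\<Sum>j\<le>n. monom (of_nat (n choose j)) (j choose m))"

text \<open>Only meaningful for \<open>n \<ge> 1\<close>, since \<open>n - 1\<close> is truncated subtraction.
  The polynomial division by \<open>1 - z\<close> (that is, \<open>[:1, -1:]\<close>) is exact, see
  \<open>Fpoly_mult_one_minus\<close> below.\<close>
definition Fpoly :: "nat \<Rightarrow> nat \<Rightarrow> real poly" where
  "Fpoly m n = ((fpoly m n)\<^sup>2 - fpoly m (n - 1) * fpoly m (n + 1)) div [:1, -1:]"

text \<open>Log-concavity of the sequence \<open>(a n)\<close> indexed by \<open>n \<ge> k\<close>: the inequality is required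
  at every \<open>n\<close> with \<open>n - 1 \<ge> k\<close>, so that all three terms belong to the sequence.\<close>
definition log_concave_from :: "nat \<Rightarrow> (nat \<Rightarrow> real) \<Rightarrow> bool" where
  "log_concave_from k a \<longleftrightarrow> (\<forall>n>k. (a n)\<^sup>2 \<ge> a (n - 1) * a (n + 1))"

lemma poly_fpoly: "poly (fpoly m n) z = (\<Sum>j\<le>n. real (n choose j) * z ^ (j choose m))"
  by (simp add: fpoly_def poly_sum poly_monom)

lemma poly_fpoly_1: "poly (fpoly m n) 1 = 2 ^ n"
proof -
  have "poly (fpoly m n) 1 = real (\<Sum>j\<le>n. n choose j)"
    by (simp add: poly_fpoly)
  then show ?thesis
    by (simp add: choose_row_sum)
qed

lemma Fpoly_mult_one_minus:
  assumes "n \<ge> 1"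
  shows "Fpoly m n * [:1, -1:] = (fpoly m n)\<^sup>2 - fpoly m (n - 1) * fpoly m (n + 1)"
proof -
  let ?N = "(fpoly m n)\<^sup>2 - fpoly m (n - 1) * fpoly m (n + 1)"
  have "poly ?N 1 = 0"
    using assms by (cases n) (simp_all add: poly_fpoly_1 power2_eq_square)
  then have "[:- 1, 1:] dvd ?N"
    by (simp only: poly_eq_0_iff_dvd)
  then have "- [:- 1, 1:] dvd ?N"
    by (simp only: minus_dvd_iff)
  then have "[:1, -1:] dvd ?N"
    by simp
  then show ?thesis
    unfolding Fpoly_def by (rule dvd_div_mult_self)
qed

lemma poly_Fpoly:
  assumes "n \<ge> 1" "z \<noteq> 1"
  shows "poly (Fpoly m n) z =
    ((poly (fpoly m n) z)\<^sup>2 - poly (fpoly m (n - 1)) z * poly (fpoly m (n + 1)) z) / (1 - z)"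
proof -
  have "poly (Fpoly m n) z * (1 - z) = poly (Fpoly m n * [:1, -1:]) z"
    by (simp add: algebra_simps)
  also have "\<dots> = (poly (fpoly m n) z)\<^sup>2 - poly (fpoly m (n - 1)) z * poly (fpoly m (n + 1)) z"
    unfolding Fpoly_mult_one_minus[OF assms(1)] by simp
  finally show ?thesis
    using assms(2) by (simp add: eq_divide_eq)
qed

end

theory Submission
  imports Defs
begin

text \<open>Write \<open>a\<^sub>j = z ^ (j choose m)\<close>, \<open>w\<^sub>p = (n - 1) choose p\<close>, \<open>u\<^sub>p = w\<^bsub>p - 1\<^esub>\<close> (with \<open>u\<^sub>0 = 0\<close>).
  Expanding \<open>f\<^sub>n\<close> and \<open>f\<^bsub>n + 1\<^esub>\<close> over row \<open>n - 1\<close> by Pascal's rule and antisymmetrising the resulting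
  double sum gives the Cauchy--Binet type identity
  \<open>f\<^sub>n\<^sup>2 - f\<^bsub>n - 1\<^esub> f\<^bsub>n + 1\<^esub> = (\<Sum>p<q. (w\<^sub>p u\<^sub>q - w\<^sub>q u\<^sub>p) (a\<^bsub>p + 1\<^esub> a\<^sub>q - a\<^sub>p a\<^bsub>q + 1\<^esub>))\<close>.
  The first factor is nonnegative because binomial rows are log-concave. The second is
  \<open>z\<^sup>c (1 - z\<^sup>d)\<close> with \<open>d = (q choose (m - 1)) - (p choose (m - 1)) \<ge> 0\<close>, so dividing by \<open>1 - z\<close>
  leaves a polynomial with nonnegative coefficients. The term \<open>p = 0\<close>, \<open>q = m - 1\<close> is the
  constant \<open>(n - 1) choose (m - 2)\<close>, which is positive for \<open>n \<ge> m - 1\<close>.\<close>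

definition binomial_transform :: "(nat \<Rightarrow> 'a::comm_ring_1) \<Rightarrow> nat \<Rightarrow> 'a" where
  "binomial_transform a n = (\<Sum>j\<le>n. of_nat (n choose j) * a j)"

text \<open>A case distinction, because \<open>n choose (k - 1)\<close> would be 1 instead of 0 at
  \<open>k = 0\<close>.\<close>

definition choose_pred :: "nat \<Rightarrow> nat \<Rightarrow> nat" where
  "choose_pred n k = (case k of 0 \<Rightarrow> 0 | Suc j \<Rightarrow> n choose j)"

lemma choose_pred_simps [simp]:
  "choose_pred n 0 = 0" "choose_pred n (Suc k) = n choose k"
  by (simp_all add: choose_pred_def)

text \<open>The extra term, at \<open>j = n + 1\<close>, is zero; the range now agrees with that of
  \<open>binomial_transform_shift\<close>.\<close>

lemma binomial_transform_extend:
  "binomial_transform a n = (\<Sum>j<Suc (Suc n). of_nat (n choose j) * a j)"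
  by (simp add: binomial_transform_def binomial_eq_0 lessThan_Suc_atMost)

lemma binomial_transform_shift:
  "binomial_transform (\<lambda>j. a (Suc j)) n = (\<Sum>j<Suc (Suc n). of_nat (choose_pred n j) * a j)"
  by (subst sum.lessThan_Suc_shift) (simp add: binomial_transform_def lessThan_Suc_atMost)

lemma binomial_transform_Suc:
  "binomial_transform a (Suc n) = binomial_transform a n + binomial_transform (\<lambda>j. a (Suc j)) n"
proof -
  have "Suc n choose j = (n choose j) + choose_pred n j" for j
    by (cases j) simp_all
  then show ?thesis
    unfolding binomial_transform_extend[of a n] binomial_transform_shift
    by (simp add: binomial_transform_def lessThan_Suc_atMost sum.distrib ring_distribs del: sum.atMost_Suc)
qed

lemma sum_square_split_triangle:
  fixes h :: "nat \<Rightarrow> nat \<Rightarrow> 'a::comm_monoid_add"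
  shows "(\<Sum>p<n. \<Sum>q<n. h p q) = (\<Sum>q<n. \<Sum>p<q. h p q + h q p) + (\<Sum>q<n. h q q)"
  by (induction n) (simp_all add: sum.distrib ac_simps)

lemma binomial_transform_Turan:
  fixes a :: "nat \<Rightarrow> 'a::comm_ring_1"
  shows "(binomial_transform a (Suc n))\<^sup>2 - binomial_transform a n * binomial_transform a (Suc (Suc n)) =
    (\<Sum>q<Suc (Suc n). \<Sum>p<q.
      (of_nat ((n choose p) * choose_pred n q) - of_nat ((n choose q) * choose_pred n p)) *
      (a (Suc p) * a q - a p * a (Suc q)))" (is "?L = ?R")
proof -
  let ?S = "{..<Suc (Suc n)}"
  let ?w = "\<lambda>p. of_nat (n choose p) :: 'a" and ?u = "\<lambda>p. of_nat (choose_pred n p) :: 'a"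
  define d where "d p q = a (Suc p) * a q - a p * a (Suc q)" for p q
  let ?B = "binomial_transform"
  \<comment> \<open>With A, B, C the transforms of \<open>a\<close> shifted by 0, 1, 2 places, this
    is (A + B)^2 - A (A + 2B + C) = B^2 - A C.\<close>
  have "?L = ?B (\<lambda>j. a (Suc j)) n * ?B (\<lambda>j. a (Suc j)) n - ?B a n * ?B (\<lambda>j. a (Suc (Suc j))) n"
    by (simp add: binomial_transform_Suc power2_eq_square algebra_simps)
  \<comment> \<open>First factors get the weights \<open>?w\<close>, second factors
    \<open>?u\<close>, so that both double sums share the coefficient
    \<open>?w p * ?u q\<close>.\<close>
  also have "\<dots> = (\<Sum>p\<in>?S. ?w p * a (Suc p)) * (\<Sum>q\<in>?S. ?u q * a q)
      - (\<Sum>p\<in>?S. ?w p * a p) * (\<Sum>q\<in>?S. ?u q * a (Suc q))"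
    using binomial_transform_shift[of a n] binomial_transform_shift[of "\<lambda>j. a (Suc j)" n]
      binomial_transform_extend[of a n] binomial_transform_extend[of "\<lambda>j. a (Suc j)" n]
    by metis
  also have "\<dots> = (\<Sum>p\<in>?S. \<Sum>q\<in>?S. ?w p * ?u q * d p q)"
    unfolding sum_product sum_subtractf[symmetric]
    by (intro sum.cong refl) (simp add: d_def algebra_simps)
  also have "\<dots> = (\<Sum>q\<in>?S. \<Sum>p<q. ?w p * ?u q * d p q + ?w q * ?u p * d q p)
      + (\<Sum>q\<in>?S. ?w q * ?u q * d q q)"
    by (rule sum_square_split_triangle)
  also have "(\<Sum>q\<in>?S. ?w q * ?u q * d q q) = 0"
    by (intro sum.neutral) (simp add: d_def mult.commute)
  \<comment> \<open>The two terms merge because \<open>d q p = - d p q\<close>.\<close>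
  also have "(\<Sum>q\<in>?S. \<Sum>p<q. ?w p * ?u q * d p q + ?w q * ?u p * d q p) + 0 = ?R"
    unfolding add_0_right
    by (intro sum.cong refl) (simp add: d_def algebra_simps)
  finally show ?thesis .
qed

lemma Suc_times_binomial_Suc: "Suc k * (n choose Suc k) = (n - k) * (n choose k)"
  by (metis binomial_absorption binomial_absorb_comp)

text \<open>Scaling by \<open>Suc p * Suc q\<close> and absorption reduce this to
  \<open>Suc p * (n - q) \<le> Suc q * (n - p)\<close>.\<close>

lemma binomial_row_log_concave:
  assumes "p \<le> q"
  shows "(n choose Suc q) * (n choose p) \<le> (n choose Suc p) * (n choose q)"
proof -
  have "(Suc p * Suc q) * ((n choose Suc q) * (n choose p)) =
      Suc p * (Suc q * (n choose Suc q)) * (n choose p)"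
    by (simp only: ac_simps)
  also have "\<dots> = (Suc p * (n - q)) * ((n choose q) * (n choose p))"
    by (simp only: Suc_times_binomial_Suc ac_simps)
  also have "\<dots> \<le> (Suc q * (n - p)) * ((n choose q) * (n choose p))"
    using assms by (intro mult_mono) auto
  also have "\<dots> = Suc q * (Suc p * (n choose Suc p)) * (n choose q)"
    by (simp only: Suc_times_binomial_Suc ac_simps)
  also have "\<dots> = (Suc p * Suc q) * ((n choose Suc p) * (n choose q))"
    by (simp only: ac_simps)
  finally show ?thesis
    by (simp only: mult_le_cancel1) simp
qed

text \<open>For \<open>p > 0\<close> this is row log-concavity at \<open>p - 1\<close> and
  \<open>q - 1\<close>. It makes the natural-number subtraction of the weights in
  \<open>Fpoly_Suc\<close> exact.\<close>

lemma choose_pred_minor_nonneg: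
  assumes "p < q"
  shows "(n choose q) * choose_pred n p \<le> (n choose p) * choose_pred n q"
  using assms by (cases p; cases q) (auto intro: binomial_row_log_concave)

lemma Fpoly_Suc:
  assumes "m \<ge> 1"
  shows "Fpoly m (Suc n) = (\<Sum>q<Suc (Suc n). \<Sum>p<q.
      of_nat ((n choose p) * choose_pred n q - (n choose q) * choose_pred n p) *
      (monom 1 ((Suc p choose m) + (q choose m)) *
        (\<Sum>i<(q choose (m - 1)) - (p choose (m - 1)). monom 1 i)))" (is "_ = ?G")
proof -
  define x where "x = monom (1::real) 1"
  have monom_x: "monom 1 k = x ^ k" for k
    by (simp add: x_def monom_power)
  have fpoly: "fpoly m k = binomial_transform (\<lambda>j. x ^ (j choose m)) k" for k
    unfolding fpoly_def binomial_transform_def monom_x[symmetric]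
    by (intro sum.cong refl) (simp add: of_nat_poly smult_monom)
  have factor: "x ^ (Suc p choose m) * x ^ (q choose m) - x ^ (p choose m) * x ^ (Suc q choose m) =
      (1 - x) * (x ^ ((Suc p choose m) + (q choose m)) *
        (\<Sum>i<(q choose (m - 1)) - (p choose (m - 1)). x ^ i))"
    if "p < q" for p q
  proof -
    obtain l where m: "m = Suc l"
      using assms by (cases m) auto
    define d where "d = (q choose l) - (p choose l)"
    have "p choose l \<le> q choose l"
      using that by (intro binomial_right_mono) simp
    \<comment> \<open>Pascal's rule at \<open>Suc p\<close> and at \<open>Suc q\<close>.\<close>
    then have "(p choose m) + (Suc q choose m) = ((Suc p choose m) + (q choose m)) + d"
      by (simp add: m d_def)
    then have "x ^ (Suc p choose m) * x ^ (q choose m) - x ^ (p choose m) * x ^ (Suc q choose m) =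
        x ^ ((Suc p choose m) + (q choose m)) * (1 - x ^ d)"
      by (simp only: power_add[symmetric] right_diff_distrib mult_1_right)
    then show ?thesis
      by (simp add: one_diff_power_eq m d_def ac_simps)
  qed
  have "Fpoly m (Suc n) * [:1, -1:] = (fpoly m (Suc n))\<^sup>2 - fpoly m n * fpoly m (Suc (Suc n))"
    using Fpoly_mult_one_minus[of "Suc n" m] by simp
  also have "\<dots> = (1 - x) * ?G"
    unfolding fpoly binomial_transform_Turan sum_distrib_left monom_x
    by (intro sum.cong refl)
      (simp add: factor of_nat_diff[OF choose_pred_minor_nonneg] sum_distrib_left mult.left_commute)
  also have "1 - x = [:1, -1:]"
    by (simp add: x_def monom_altdef one_pCons)
  also have "[:1, -1:] * ?G = ?G * [:1, -1:]"
    by (rule mult.commute)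
  finally show ?thesis
    by (rule mult_right_cancel[THEN iffD1, rotated]) simp
qed

lemma poly_Fpoly_ge:
  assumes "m \<ge> 2" "n \<ge> m - 1" "z \<ge> 0"
  shows "poly (Fpoly m n) z \<ge> real ((n - 1) choose (m - 2))"
proof -
  obtain l where m: "m = Suc (Suc l)"
    using assms(1) by (metis Suc_le_D numeral_2_eq_2 Suc_le_mono)
  obtain k where n: "n = Suc k"
    using assms(2) m by (cases n) auto
  let ?t = "\<lambda>p q. real ((k choose p) * choose_pred k q - (k choose q) * choose_pred k p) *
      (z ^ ((Suc p choose m) + (q choose m)) *
        (\<Sum>i<(q choose (m - 1)) - (p choose (m - 1)). z ^ i))"
  have nonneg: "?t p q \<ge> 0" for p q
    using assms(3) by (intro mult_nonneg_nonneg sum_nonneg) auto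
  \<comment> \<open>Here both binomials in the exponent of \<open>z\<close> vanish and the geometric
    sum has the single term 1.\<close>
  have "real ((n - 1) choose (m - 2)) = ?t 0 (Suc l)"
    by (simp add: m n binomial_eq_0)
  also have "\<dots> \<le> (\<Sum>p<Suc l. ?t p (Suc l))"
    by (rule member_le_sum[where f = "\<lambda>p. ?t p (Suc l)"]) (simp, rule nonneg, simp)
  \<comment> \<open>The index \<open>q = m - 1\<close> lies in the range because
    \<open>n \<ge> m - 1\<close>.\<close>
  also have "\<dots> \<le> (\<Sum>q<Suc (Suc k). \<Sum>p<q. ?t p q)"
    by (rule member_le_sum[where f = "\<lambda>q. \<Sum>p<q. ?t p q"])
      (use assms(2) in \<open>simp add: m n\<close>, intro sum_nonneg nonneg, simp)
  also have "\<dots> = poly (Fpoly m n) z"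
    using assms(1) by (simp only: n Fpoly_Suc) (simp add: Fpoly_Suc poly_sum poly_monom)
  finally show ?thesis .
qed

theorem proposition3p3:
  fixes m :: nat
  assumes "m \<ge> 2"
  shows "(\<forall>n\<ge>m - 1. \<forall>z::real. z \<ge> 0 \<longrightarrow> poly (Fpoly m n) z > 0) \<and>
         (\<forall>z::real. 0 \<le> z \<and> z \<le> 1 \<longrightarrow> log_concave_from (m - 1) (\<lambda>n. poly (fpoly m n) z))"
proof (intro conjI allI impI)
  fix n and z :: real
  assume "n \<ge> m - 1" "z \<ge> 0"
  moreover from this assms have "0 < (n - 1) choose (m - 2)"
    by simp
  ultimately show "poly (Fpoly m n) z > 0"
    using poly_Fpoly_ge[OF assms] by (meson less_le_trans of_nat_0_less_iff)
next
  fix z :: real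
  assume z: "0 \<le> z \<and> z \<le> 1"
  show "log_concave_from (m - 1) (\<lambda>n. poly (fpoly m n) z)"
    unfolding log_concave_from_def
  proof (intro allI impI)
    fix n assume n: "n > m - 1"
    \<comment> \<open>Multiplying by \<open>1 - z\<close> instead of dividing covers
      \<open>z = 1\<close> as well.\<close>
    have "0 \<le> poly (Fpoly m n) z * (1 - z)"
      using poly_Fpoly_ge[OF assms, of n z] n z by (intro mult_nonneg_nonneg) auto
    also have "\<dots> = poly (Fpoly m n * [:1, -1:]) z"
      by (simp add: algebra_simps)
    also have "\<dots> = (poly (fpoly m n) z)\<^sup>2 - poly (fpoly m (n - 1)) z * poly (fpoly m (n + 1)) z"
      using n by (simp add: Fpoly_mult_one_minus del: mult_pCons_right)
    finally show "(poly (fpoly m n) z)\<^sup>2 \<ge> poly (fpoly m (n - 1)) z * poly (fpoly m (n + 1)) z"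
      by simp
  qed
qed

end
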